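(* Let $N\ge 1$, $\delta\ge 0$, let $\mathbf G=(g_{ij})\in\mathbb R^{N\times N}$ with $g_{ii}=0$ for all $i$, let $\mathcal P\subseteq\mathbb R^N$ be closed and convex, and let $a_i,b_i\in\mathbb R$. For each $i\in\mathcal N=\{1,\dots,N\}$ let $\mathcal X_i\subseteq\mathbb R_+$ and let $h_i:\mathcal X_i\to\mathbb R$ be convex and continuously differentiable. Assume that one of the following holds: (1) for all $i$, $\mathcal X_i$ is nonempty, convex and compact; or (2) for all $i$, $\mathcal X_i$ is nonempty, convex and closed, and $\lim_{x_i\in\mathcal X_i,\,|x_i|\to\infty} h_i(x_i)/|x_i|=+\infty$. Assume moreover that each $h_i$ is $\mu_i$-strongly convex for some $\mu_i>0$, i.e. $h_i(y)\ge h_i(x)+h_i'(x)(y-x)+\frac{\mu_i}{2}|y-x|^2$ for all $x,y\in\mathcal X_i$. Let $\mathbf D=\operatorname{diag}(\mu_1,\dots,\mu_N)$ and let $|\mathbf G|=(|g_{ij}|)_{i,j}$. If either $$\rho\bigl(\delta\,\mathbf D^{-1}|\mathbf G|\bigr)<1\qquad\text{(contraction condition)}$$ or $$\mathbf D-\delta\,\tfrac{\mathbf G+\mathbf G^\top}{2}\succ 0\qquad\text{(variational condition)}$$ holds, then for every $\mathbf p\in\mathcal P$ the consumer game with price vector $\mathbf p$ admits a unique Nash equilibrium $\mathbf x^\star(\mathbf p)\in\mathcal X=\prod_{i=1}^N\mathcal X_i$.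
   Context: Consumer game: given prices $\mathbf p=(p_1,\dots,p_N)\in\mathcal P$, each consumer $i\in\mathcal N$ chooses $x_i\in\mathcal X_i$ to maximize $$u_i(x_i,\mathbf x_{-i};p_i)=s_i(\mathbf x_{-i};p_i)\,x_i-h_i(x_i),\qquad s_i(\mathbf x_{-i};p_i)=a_i-b_ip_i+\delta\sum_{j=1}^N g_{ij}x_j .$$ The best response of $i$ is the set $\Gamma_i(\mathbf x_{-i};p_i)=\arg\max_{x_i\in\mathcal X_i}u_i(x_i,\mathbf x_{-i};p_i)$. A Nash equilibrium at $\mathbf p$ is a vector $\mathbf x^\star\in\mathcal X$ with $x_i^\star\in\Gamma_i(\mathbf x^\star_{-i};p_i)$ for all $i\in\mathcal N$. $\rho(\cdot)$ is the spectral radius. For square real matrices, $\mathbf M\succ \mathbf M'$ means $\mathbf z^\top\mathbf M\mathbf z>\mathbf z^\top\mathbf M'\mathbf z$ for all $\mathbf z\ne\mathbf 0$. Derivatives at endpoints of an interval are one-sided. *)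

theory Defs
  imports "HOL-Analysis.Analysis"
begin

definition diag_matrix :: "real ^ 'n \<Rightarrow> real ^ 'n ^ 'n" where
  "diag_matrix d = (\<chi> i j. if i = j then d $ i else 0)"

definition abs_matrix :: "real ^ 'n ^ 'n \<Rightarrow> real ^ 'n ^ 'n" where
  "abs_matrix M = (\<chi> i j. \<bar>M $ i $ j\<bar>)"

(* All complex eigenvalues of a real matrix, not only the real ones. *)
definition complex_spectrum :: "real ^ 'n ^ 'n \<Rightarrow> complex set" where
  "complex_spectrum M =
     {z. \<exists>v :: complex ^ 'n. v \<noteq> 0 \<and> (\<chi> i j. complex_of_real (M $ i $ j)) *v v = z *s v}"

(* The spectrum is finite and nonempty, so this supremum is a maximum. *)
definition matrix_spectral_radius :: "real ^ 'n ^ 'n \<Rightarrow> real" where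
  "matrix_spectral_radius M = (SUP z\<in>complex_spectrum M. cmod z)"

(* The matrices are not required to be symmetric. *)
definition matrix_succ :: "real ^ 'n ^ 'n \<Rightarrow> real ^ 'n ^ 'n \<Rightarrow> bool"  (infix "\<succ>\<^sub>M" 50) where
  "M \<succ>\<^sub>M M' \<longleftrightarrow> (\<forall>z. z \<noteq> 0 \<longrightarrow> z \<bullet> (M *v z) > z \<bullet> (M' *v z))"

(* The rivals' actions x_{-i} are passed as a full profile x.  The sum runs over all j; when
   G $ i $ i = 0 the coordinate x $ i has no influence. *)
definition marginal_value ::
  "real ^ 'n \<Rightarrow> real ^ 'n \<Rightarrow> real \<Rightarrow> real ^ 'n ^ 'n \<Rightarrow> 'n \<Rightarrow> real ^ 'n \<Rightarrow> real \<Rightarrow> real" where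
  "marginal_value a b \<delta> G i x q = a $ i - b $ i * q + \<delta> * (\<Sum>j\<in>UNIV. G $ i $ j * x $ j)"

(* y is consumer i's own action and q her price. *)
definition utility ::
  "real ^ 'n \<Rightarrow> real ^ 'n \<Rightarrow> real \<Rightarrow> real ^ 'n ^ 'n \<Rightarrow> ('n \<Rightarrow> real \<Rightarrow> real)
     \<Rightarrow> 'n \<Rightarrow> real \<Rightarrow> real ^ 'n \<Rightarrow> real \<Rightarrow> real" where
  "utility a b \<delta> G h i y x q = marginal_value a b \<delta> G i x q * y - h i y"

definition best_response ::
  "real ^ 'n \<Rightarrow> real ^ 'n \<Rightarrow> real \<Rightarrow> real ^ 'n ^ 'n \<Rightarrow> ('n \<Rightarrow> real \<Rightarrow> real) \<Rightarrow> ('n \<Rightarrow> real set)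
     \<Rightarrow> 'n \<Rightarrow> real ^ 'n \<Rightarrow> real \<Rightarrow> real set" where
  "best_response a b \<delta> G h X i x q =
     {y. is_arg_max (\<lambda>y. utility a b \<delta> G h i y x q) (\<lambda>y. y \<in> X i) y}"

definition nash_equilibrium ::
  "real ^ 'n \<Rightarrow> real ^ 'n \<Rightarrow> real \<Rightarrow> real ^ 'n ^ 'n \<Rightarrow> ('n \<Rightarrow> real \<Rightarrow> real) \<Rightarrow> ('n \<Rightarrow> real set)
     \<Rightarrow> real ^ 'n \<Rightarrow> real ^ 'n \<Rightarrow> bool" where
  "nash_equilibrium a b \<delta> G h X p x \<longleftrightarrow>
     (\<forall>i. x $ i \<in> X i) \<and> (\<forall>i. x $ i \<in> best_response a b \<delta> G h X i x (p $ i))"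

end

theory Submission
  imports Defs
begin

text \<open>
  An action profile \<open>x\<close> is a Nash equilibrium iff each \<open>x\<^sub>i\<close> solves the scalar variational inequality
  \<open>(h\<^sub>i'(x\<^sub>i) - s\<^sub>i(x)) (z - x\<^sub>i) \<ge> 0\<close> for all \<open>z\<close> in \<open>X\<^sub>i\<close>. Strong convexity makes the solution of such
  an inequality exist and depend Lipschitz continuously on \<open>s\<^sub>i\<close> with
  constant \<open>1 / \<mu>\<^sub>i\<close>; it is defined for every real \<open>s\<^sub>i\<close>, so all fixed-point maps below act on the
  whole space.

  Under the contraction condition the best-response map satisfies
  \<open>|F x - F y| \<le> A |x - y|\<close> componentwise with \<open>A = \<delta> D\<^sup>-\<^sup>1 |G|\<close>. A positive vector \<open>v\<close> with \<open>A v < v\<close>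
  is obtained by following the solution of \<open>(I - t A) v = 1\<close> from \<open>t = 0\<close> to \<open>t = 1\<close>, and \<open>F\<close> contracts
  the maximum norm weighted by \<open>v\<close>.

  Under the variational condition the same inequality is solved by forward-backward splitting:
  with \<open>B = D - \<delta> G\<close>, the explicit step \<open>x \<mapsto> x - B x / \<kappa>\<close> is a Euclidean contraction for large \<open>\<kappa>\<close>,
  and the implicit step, with the convex potentials \<open>h\<^sub>i(y) - \<mu>\<^sub>i y\<^sup>2 / 2\<close>, is nonexpansive.
\<close>

section \<open>Scalar variational inequalities\<close>

text \<open>Kept abstract because two families are plugged in: the costs \<open>h i\<close> with
  moduli \<open>\<mu> $ i\<close>, and the costs altered by a multiple of the square so that the
  modulus becomes \<open>\<kappa>\<close>.\<close>

locale strongly_convex_potential =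
  fixes X :: "real set" and \<phi> \<phi>' :: "real \<Rightarrow> real" and m :: real
  assumes nonempty: "X \<noteq> {}" and closed: "closed X" and convex: "convex X"
    and deriv: "x \<in> X \<Longrightarrow> (\<phi> has_real_derivative \<phi>' x) (at x within X)"
    and strong: "x \<in> X \<Longrightarrow> y \<in> X \<Longrightarrow> \<phi> y \<ge> \<phi> x + \<phi>' x * (y - x) + m / 2 * (y - x)\<^sup>2"
    and pos: "m > 0"
begin

definition solves_vi :: "real \<Rightarrow> real \<Rightarrow> bool" where
  "solves_vi s y \<longleftrightarrow> y \<in> X \<and> (\<forall>z\<in>X. 0 \<le> (\<phi>' y - s) * (z - y))"

text \<open>A linear term shifts the derivative by a constant and leaves \<open>m\<close> unchanged,
  so facts about minimizers of \<open>\<phi>\<close> transfer to every \<open>s\<close>.\<close>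

lemma tilt: "strongly_convex_potential X (\<lambda>y. \<phi> y - s * y) (\<lambda>y. \<phi>' y - s) m"
proof
  fix x y assume xy: "x \<in> X" "y \<in> X"
  show "((\<lambda>y. \<phi> y - s * y) has_real_derivative \<phi>' x - s) (at x within X)"
    by (auto intro!: derivative_eq_intros deriv xy)
  show "\<phi> x - s * x + (\<phi>' x - s) * (y - x) + m / 2 * (y - x)\<^sup>2 \<le> \<phi> y - s * y"
    using strong[OF xy] by (simp add: algebra_simps)
qed (use nonempty closed convex pos in auto)

text \<open>Beyond distance \<open>r\<close> from \<open>x0\<close> the quadratic term of strong
  convexity outweighs the linear one, so \<open>\<phi>\<close> is at least \<open>\<phi> x0\<close>
  there and a minimizer on the compact set \<open>X \<inter> cball x0 r\<close> is global.\<close>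

lemma minimizer_exists: "\<exists>y\<in>X. \<forall>z\<in>X. \<phi> y \<le> \<phi> z"
proof -
  obtain x0 where x0: "x0 \<in> X" using nonempty by blast
  define r where "r = 2 * \<bar>\<phi>' x0\<bar> / m"
  have "r \<ge> 0" using pos by (simp add: r_def)
  have "compact (X \<inter> cball x0 r)" using closed by (simp add: closed_Int_compact)
  moreover have "X \<inter> cball x0 r \<noteq> {}" using x0 \<open>r \<ge> 0\<close> by auto
  moreover have "continuous_on X \<phi>"
    by (auto simp: continuous_on_eq_continuous_within intro!: DERIV_continuous deriv)
  then have "continuous_on (X \<inter> cball x0 r) \<phi>" by (rule continuous_on_subset) auto
  ultimately obtain y where y: "y \<in> X \<inter> cball x0 r" "\<forall>z\<in>X \<inter> cball x0 r. \<phi> y \<le> \<phi> z"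
    using continuous_attains_inf by blast
  have "\<phi> x0 \<le> \<phi> z" if z: "z \<in> X" "z \<notin> cball x0 r" for z
  proof -
    have "2 * \<bar>\<phi>' x0\<bar> < m * \<bar>z - x0\<bar>"
      using z pos by (simp add: r_def dist_real_def divide_simps abs_minus_commute mult.commute)
    then have "2 * \<bar>\<phi>' x0\<bar> * \<bar>z - x0\<bar> \<le> m * \<bar>z - x0\<bar> * \<bar>z - x0\<bar>"
      by (intro mult_right_mono) auto
    then have "2 * \<bar>\<phi>' x0 * (z - x0)\<bar> \<le> m * (z - x0)\<^sup>2"
      by (simp add: abs_mult power2_eq_square mult.assoc)
    then show ?thesis using strong[OF x0 z(1)] by linarith
  qed
  moreover have "\<phi> y \<le> \<phi> x0" using y(2) x0 \<open>r \<ge> 0\<close> by auto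
  ultimately show ?thesis using y by (metis IntD1 IntI order_trans)
qed

lemma minimizer_iff:
  assumes y: "y \<in> X"
  shows "(\<forall>z\<in>X. \<phi> y \<le> \<phi> z) \<longleftrightarrow> (\<forall>z\<in>X. 0 \<le> \<phi>' y * (z - y))"
proof (intro iffI ballI)
  fix z assume min: "\<forall>z\<in>X. \<phi> y \<le> \<phi> z" and z: "z \<in> X"
  \<comment> \<open>Along this segment the derivative within \<open>X\<close> becomes a one-sided
    derivative at 0, which covers endpoints of \<open>X\<close>; a negative slope would push
    \<open>\<phi>\<close> below its minimum.\<close>
  define g where "g t = y + t * (z - y)" for t :: real
  have gX: "g t \<in> X" if "0 \<le> t" "t \<le> 1" for t
    using convexD_alt[OF convex y z that] by (simp add: g_def algebra_simps)
  have "(\<phi> has_real_derivative \<phi>' y) (at (g 0) within g ` {0..1})"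
    by (rule has_field_derivative_subset) (use deriv[OF y] gX in \<open>auto simp: g_def\<close>)
  moreover have "(g has_real_derivative (z - y)) (at 0 within {0..1})"
    unfolding g_def by (auto intro!: derivative_eq_intros)
  ultimately have der: "(\<phi> \<circ> g has_real_derivative \<phi>' y * (z - y)) (at 0 within {0..1})"
    by (rule DERIV_image_chain)
  show "0 \<le> \<phi>' y * (z - y)"
  proof (rule ccontr)
    assume "\<not> ?thesis"
    then obtain d where d: "d > 0" "\<forall>h>0. 0 + h \<in> {0..1} \<longrightarrow> h < d \<longrightarrow> (\<phi> \<circ> g) (0 + h) < (\<phi> \<circ> g) 0"
      using has_real_derivative_neg_dec_right[OF der] by auto
    define h where "h = min 1 (d / 2)"
    have h: "0 < h" "h \<le> 1" "h < d" using d(1) by (auto simp: h_def)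
    then have "\<phi> (g h) < \<phi> (g 0)" using d(2) by auto
    moreover have "\<phi> y \<le> \<phi> (g h)" using min gX h by auto
    ultimately show False by (simp add: g_def)
  qed
next
  fix z assume vi: "\<forall>z\<in>X. 0 \<le> \<phi>' y * (z - y)" and z: "z \<in> X"
  have "0 \<le> m / 2 * (z - y)\<^sup>2" using pos by simp
  then show "\<phi> y \<le> \<phi> z" using vi z strong[OF y z] by force
qed

lemma solves_vi_iff_minimizer:
  "solves_vi s y \<longleftrightarrow> y \<in> X \<and> (\<forall>z\<in>X. \<phi> y - s * y \<le> \<phi> z - s * z)"
  unfolding solves_vi_def
  using strongly_convex_potential.minimizer_iff[OF tilt[of s]] by blast

lemma solves_vi_exists: "\<exists>y. solves_vi s y"
  using strongly_convex_potential.minimizer_exists[OF tilt[of s]]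
  by (auto simp: solves_vi_iff_minimizer)

text \<open>Testing each inequality at the other solution bounds
  \<open>(\<phi>' y - \<phi>' w) * (y - w)\<close> above by \<open>(s - t) * (y - w)\<close>; strong
  convexity bounds it below by \<open>m * (y - w)\<^sup>2\<close>. The case \<open>s = t\<close> is
  uniqueness.\<close>

lemma solves_vi_Lipschitz:
  assumes "solves_vi s y" "solves_vi t w"
  shows "\<bar>y - w\<bar> \<le> \<bar>s - t\<bar> / m"
proof -
  have X: "y \<in> X" "w \<in> X"
    and vi: "0 \<le> (\<phi>' y - s) * (w - y)" "0 \<le> (\<phi>' w - t) * (y - w)"
    using assms by (auto simp: solves_vi_def)
  have "m * (y - w)\<^sup>2 \<le> (\<phi>' y - \<phi>' w) * (y - w)"
    using strong[OF X] strong[OF X(2,1)] by (simp add: algebra_simps power2_eq_square)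
  also have "\<dots> \<le> (s - t) * (y - w)" using vi by (simp add: algebra_simps)
  also have "\<dots> \<le> \<bar>s - t\<bar> * \<bar>y - w\<bar>" by (metis abs_ge_self abs_mult)
  finally have "(m * \<bar>y - w\<bar>) * \<bar>y - w\<bar> \<le> \<bar>s - t\<bar> * \<bar>y - w\<bar>"
    by (simp add: power2_eq_square mult.assoc)
  then have "m * \<bar>y - w\<bar> \<le> \<bar>s - t\<bar>"
    by (cases "y = w") (auto simp: mult_le_cancel_right)
  then show ?thesis using pos by (simp add: field_simps)
qed

definition vi_solution :: "real \<Rightarrow> real" where
  "vi_solution s = (SOME y. solves_vi s y)"

lemma vi_solution: "solves_vi s (vi_solution s)"
  unfolding vi_solution_def using solves_vi_exists by (rule someI_ex)

lemma vi_solution_eq_iff: "vi_solution s = y \<longleftrightarrow> solves_vi s y"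
  using vi_solution solves_vi_Lipschitz[OF vi_solution, of s y s] by auto

lemma vi_solution_Lipschitz: "\<bar>vi_solution s - vi_solution t\<bar> \<le> \<bar>s - t\<bar> / m"
  by (rule solves_vi_Lipschitz) (rule vi_solution)+

end

text \<open>The scalar problems are solved with \<open>s\<close> frozen at \<open>x\<close>, so a
  fixed point solves the coupled system. An arbitrary \<open>s\<close> covers both the best-response
  map and the implicit step of the splitting.\<close>

lemma vi_fixed_point_map:
  fixes s :: "real ^ 'n \<Rightarrow> 'n \<Rightarrow> real"
  assumes scp: "\<And>i. strongly_convex_potential (X i) (\<phi> i) (\<phi>' i) (m i)"
  obtains F :: "real ^ 'n \<Rightarrow> real ^ 'n" where
    "\<And>x. F x = x \<longleftrightarrow> (\<forall>i. x $ i \<in> X i \<and> (\<forall>z\<in>X i. 0 \<le> (\<phi>' i (x $ i) - s x i) * (z - x $ i)))"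
    "\<And>x y i. \<bar>F x $ i - F y $ i\<bar> \<le> \<bar>s x i - s y i\<bar> / m i"
proof
  let ?F = "\<lambda>x. \<chi> i. strongly_convex_potential.vi_solution (X i) (\<phi>' i) (s x i)"
  show "?F x = x \<longleftrightarrow> (\<forall>i. x $ i \<in> X i \<and> (\<forall>z\<in>X i. 0 \<le> (\<phi>' i (x $ i) - s x i) * (z - x $ i)))" for x
    by (simp add: vec_eq_iff strongly_convex_potential.vi_solution_eq_iff[OF scp]
        strongly_convex_potential.solves_vi_def[OF scp])
  show "\<bar>?F x $ i - ?F y $ i\<bar> \<le> \<bar>s x i - s y i\<bar> / m i" for x y i
    by (simp add: strongly_convex_potential.vi_solution_Lipschitz[OF scp])
qed

section \<open>Nonnegative matrices of spectral radius less than one\<close>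

text \<open>Needed for the supremum in the spectral radius to be an upper bound. At a coordinate
  \<open>k\<close> of largest modulus, the eigenvalue equation bounds \<open>cmod z\<close> by the
  absolute sum of row \<open>k\<close>.\<close>

lemma bdd_above_complex_spectrum: "bdd_above (cmod ` complex_spectrum M)"
proof (rule bdd_aboveI2)
  fix z assume "z \<in> complex_spectrum M"
  then obtain v where v: "v \<noteq> 0" "(\<chi> i j. complex_of_real (M $ i $ j)) *v v = z *s v"
    by (auto simp: complex_spectrum_def)
  have "Max (range (\<lambda>i. cmod (v $ i))) \<in> range (\<lambda>i. cmod (v $ i))" by (rule Max_in) auto
  then obtain k where "Max (range (\<lambda>i. cmod (v $ i))) = cmod (v $ k)" by (rule imageE)
  then have k: "cmod (v $ i) \<le> cmod (v $ k)" for i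
    by (metis Max_ge finite finite_imageI rangeI)
  obtain i where "v $ i \<noteq> 0" using v(1) by (auto simp: vec_eq_iff)
  then have vk: "cmod (v $ k) > 0" using k[of i] by (meson zero_less_norm_iff less_le_trans)
  have "z * v $ k = (\<Sum>j\<in>UNIV. complex_of_real (M $ k $ j) * v $ j)"
    using arg_cong[OF v(2), of "\<lambda>w. w $ k"] by (simp add: matrix_vector_mult_def)
  then have "cmod z * cmod (v $ k) \<le> (\<Sum>j\<in>UNIV. cmod (complex_of_real (M $ k $ j) * v $ j))"
    by (metis norm_mult norm_sum)
  also have "\<dots> \<le> (\<Sum>j\<in>UNIV. \<bar>M $ k $ j\<bar> * cmod (v $ k))"
    by (intro sum_mono) (simp add: norm_mult k mult_left_mono)
  finally have "cmod z \<le> (\<Sum>j\<in>UNIV. \<bar>M $ k $ j\<bar>)"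
    using vk by (simp add: sum_distrib_right[symmetric])
  also have "\<dots> \<le> (\<Sum>i\<in>UNIV. \<Sum>j\<in>UNIV. \<bar>M $ i $ j\<bar>)"
    by (rule member_le_sum) (auto intro: sum_nonneg)
  finally show "cmod z \<le> (\<Sum>i\<in>UNIV. \<Sum>j\<in>UNIV. \<bar>M $ i $ j\<bar>)" .
qed

lemma real_eigenvalue_le_spectral_radius:
  fixes v :: "real ^ 'n"
  assumes "v \<noteq> 0" "M *v v = r *\<^sub>R v"
  shows "r \<le> matrix_spectral_radius M"
proof -
  let ?w = "\<chi> i. complex_of_real (v $ i)"
  have "(\<Sum>j\<in>UNIV. complex_of_real (M $ i $ j) * complex_of_real (v $ j))
      = complex_of_real r * complex_of_real (v $ i)" for i
    using arg_cong[OF assms(2), of "\<lambda>w. complex_of_real (w $ i)"]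
    by (simp add: matrix_vector_mult_def)
  then have "complex_of_real r \<in> complex_spectrum M"
    using assms(1) unfolding complex_spectrum_def
    by (auto simp: vec_eq_iff matrix_vector_mult_def intro!: exI[of _ ?w])
  then have "cmod (complex_of_real r) \<le> matrix_spectral_radius M"
    unfolding matrix_spectral_radius_def by (rule cSUP_upper[OF _ bdd_above_complex_spectrum])
  then show ?thesis by simp
qed

text \<open>A continuation argument in place of Perron-Frobenius theory: the parameters with
  positive solution form a nonempty, open and closed subset \<open>T\<close> of
  \<open>{0..1}\<close>, hence all of it. At the end point, \<open>v = 1 + A v\<close> gives the
  strict inequality.\<close>

lemma positive_subinvariant_vector:
  fixes A :: "real ^ 'n ^ 'n"
  assumes nonneg: "\<And>i j. A $ i $ j \<ge> 0" and radius: "matrix_spectral_radius A < 1"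
  obtains v where "\<And>i. v $ i > 0" "\<And>i. (A *v v) $ i < v $ i"
proof -
  define M where "M t = mat 1 - t *\<^sub>R A" for t :: real
  have Mv: "M t *v w = w - t *\<^sub>R (A *v w)" for t w
    by (simp add: M_def matrix_vector_mult_diff_rdistrib scaleR_matrix_vector_assoc)
  have det: "det (M t) \<noteq> 0" if t: "0 \<le> t" "t \<le> 1" for t
  proof -
    \<comment> \<open>A nonzero kernel vector would be an eigenvector of \<open>A\<close> with
      eigenvalue \<open>1 / t\<close>, which is at least 1.\<close>
    have "w = 0" if "M t *v w = 0" for w
    proof (rule ccontr)
      assume "w \<noteq> 0"
      have w: "w = t *\<^sub>R (A *v w)" using that by (simp add: Mv)
      then have "t \<noteq> 0" using \<open>w \<noteq> 0\<close> by auto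
      have "(1 / t) *\<^sub>R w = (1 / t) *\<^sub>R t *\<^sub>R (A *v w)" using w by (rule arg_cong)
      then have "A *v w = (1 / t) *\<^sub>R w" using \<open>t \<noteq> 0\<close> by simp
      then have "1 / t \<le> matrix_spectral_radius A"
        using \<open>w \<noteq> 0\<close> by (rule real_eigenvalue_le_spectral_radius[rotated])
      moreover have "1 \<le> 1 / t" using t \<open>t \<noteq> 0\<close> by simp
      ultimately show False using radius by linarith
    qed
    then show ?thesis
      by (metis invertible_det_nz invertible_left_inverse matrix_left_invertible_ker)
  qed
  \<comment> \<open>Cramer's rule for the right-hand side with all entries 1; quotients of
    determinants make continuity in \<open>t\<close> visible.\<close>
  define v :: "real \<Rightarrow> real ^ 'n" where
    "v t = (\<chi> k. det (\<chi> i j. if j = k then 1 else M t $ i $ j) / det (M t))" for t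
  have eq: "v t $ i = 1 + t * (A *v v t) $ i" if t: "0 \<le> t" "t \<le> 1" for t i
  proof -
    have "M t *v v t = (\<chi> i. 1)"
      unfolding cramer[OF det[OF t]] by (simp add: v_def cong: if_cong)
    then have "(v t - t *\<^sub>R (A *v v t)) $ i = 1" unfolding Mv by simp
    then show ?thesis by simp
  qed
  have entry: "continuous_on {0..1} (\<lambda>t. if P then 1 else M t $ i $ j)" for P i j
    by (cases P) (auto simp: M_def intro!: continuous_intros)
  have "continuous_on {0..1} (\<lambda>t. det (M t))"
    unfolding det_def M_def by (auto intro!: continuous_intros)
  moreover have "continuous_on {0..1} (\<lambda>t. det (\<chi> i j. if j = k then 1 else M t $ i $ j))" for k
    unfolding det_def by (auto intro!: continuous_intros entry)
  ultimately have cont: "continuous_on {0..1} v"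
    unfolding v_def using det by (auto intro!: continuous_intros)
  define T where "T = {0..1} \<inter> v -` (\<Inter>i. {x. 0 < x $ i})"
  \<comment> \<open>By \<open>v = 1 + t A v\<close>, nonnegative coordinates are automatically at
    least 1, so the open and the closed condition cut out the same set.\<close>
  have "T = {0..1} \<inter> v -` (\<Inter>i. {x. 0 \<le> x $ i})"
  proof -
    have "v t $ i > 0" if t: "0 \<le> t" "t \<le> 1" and "\<forall>i. 0 \<le> v t $ i" for t i
    proof -
      have "(A *v v t) $ i \<ge> 0"
        using that nonneg by (auto simp: matrix_vector_mult_def intro!: sum_nonneg)
      then show ?thesis using eq[OF t] t by (simp add: add_pos_nonneg)
    qed
    then have "(\<forall>i. 0 < v t $ i) \<longleftrightarrow> (\<forall>i. 0 \<le> v t $ i)" if "t \<in> {0..1}" for t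
      using that by (meson atLeastAtMost_iff less_imp_le)
    then show ?thesis unfolding T_def by blast
  qed
  moreover have "closed (\<Inter>i. {x :: real ^ 'n. 0 \<le> x $ i})"
    by (intro closed_INT ballI closed_Collect_le continuous_intros)
  ultimately have "closedin (top_of_set {0..1}) T"
    by (simp only: continuous_closedin_preimage[OF cont])
  moreover have "open (\<Inter>i. {x :: real ^ 'n. 0 < x $ i})"
    by (intro open_INT ballI open_Collect_less continuous_intros) auto
  then have "openin (top_of_set {0..1}) T"
    unfolding T_def by (rule continuous_openin_preimage_gen[OF cont])
  moreover have "0 \<in> T" using eq[of 0] by (auto simp: T_def)
  moreover have "connected {0..1::real}" by simp
  ultimately have "T = {0..1}" unfolding connected_clopen by blast
  then have "1 \<in> T" by simp
  then have "v 1 $ i > 0" for i by (auto simp: T_def)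
  moreover have "(A *v v 1) $ i < v 1 $ i" for i using eq[of 1 i] by simp
  ultimately show thesis by (rule that)
qed

lemma matrix_contraction_fixed_point:
  fixes F :: "real ^ 'n \<Rightarrow> real ^ 'n" and A :: "real ^ 'n ^ 'n"
  assumes nonneg: "\<And>i j. A $ i $ j \<ge> 0" and radius: "matrix_spectral_radius A < 1"
    and bound: "\<And>x y i. \<bar>F x $ i - F y $ i\<bar> \<le> (\<Sum>j\<in>UNIV. A $ i $ j * \<bar>x $ j - y $ j\<bar>)"
  shows "\<exists>!x. F x = x"
proof -
  obtain v where v: "\<And>i. v $ i > 0" "\<And>i. (A *v v) $ i < v $ i"
    using positive_subinvariant_vector[OF nonneg radius] by blast
  \<comment> \<open>This is the operator norm of \<open>A\<close> for the maximum norm weighted by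
    \<open>v\<close>.\<close>
  define c where "c = Max (range (\<lambda>i. (A *v v) $ i / v $ i))"
  have cge: "(A *v v) $ i / v $ i \<le> c" for i unfolding c_def by (rule Max_ge) auto
  have c1: "c < 1" unfolding c_def using v by (subst Max_less_iff) auto
  have Av: "(A *v v) $ i \<ge> 0" for i
    by (auto simp: matrix_vector_mult_def
        intro!: sum_nonneg mult_nonneg_nonneg nonneg less_imp_le[OF v(1)])
  have c0: "c \<ge> 0" using order_trans[OF divide_nonneg_pos[OF Av v(1)] cge] .
  have step: "\<bar>F x $ i - F y $ i\<bar> \<le> c * r * v $ i"
    if r: "r \<ge> 0" and le: "\<And>j. \<bar>x $ j - y $ j\<bar> \<le> r * v $ j" for x y r i
  proof -
    have "\<bar>F x $ i - F y $ i\<bar> \<le> (\<Sum>j\<in>UNIV. A $ i $ j * (r * v $ j))"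
      using bound[of x i y] by (rule order_trans) (intro sum_mono mult_left_mono le nonneg)
    also have "\<dots> = r * (A *v v) $ i"
      by (simp add: matrix_vector_mult_def sum_distrib_left mult.left_commute)
    also have "\<dots> \<le> r * (c * v $ i)"
      using cge[of i] v(1)[of i] r by (intro mult_left_mono) (simp_all add: divide_le_eq)
    finally show ?thesis by (simp add: ac_simps)
  qed
  have iterate: "\<bar>(F ^^ n) x $ i - (F ^^ n) y $ i\<bar> \<le> c ^ n * r * v $ i"
    if "r \<ge> 0" "\<And>j. \<bar>x $ j - y $ j\<bar> \<le> r * v $ j" for x y r i n
  proof (induction n arbitrary: i)
    case (Suc n)
    show ?case using step[OF _ Suc] c0 that(1) by (simp add: mult.assoc)
  qed (use that in simp)
  define l where "l = Min (range (($) v))"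
  have l: "l > 0" "l \<le> v $ j" for j unfolding l_def using v(1) by auto
  \<comment> \<open>\<open>K\<close> pays for passing between the weighted maximum norm and the
    Euclidean one. \<open>F\<close> itself may fail to contract Euclidean distance, but an iterate
    with \<open>c ^ n * K < 1\<close> does.\<close>
  define K where "K = (\<Sum>i\<in>UNIV. v $ i) / l"
  have K: "K \<ge> 0" unfolding K_def by (intro divide_nonneg_pos sum_nonneg less_imp_le[OF v(1)] l(1))
  have "(\<lambda>n. c ^ n * K) \<longlonglongrightarrow> 0 * K" by (intro tendsto_intros LIMSEQ_realpow_zero c0 c1)
  then have "eventually (\<lambda>n. c ^ n * K < 1) sequentially" by (simp add: order_tendstoD)
  then obtain n where n: "c ^ n * K < 1" by (auto simp: eventually_sequentially)
  have "dist ((F ^^ n) x) ((F ^^ n) y) \<le> (c ^ n * K) * dist x y" for x y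
  proof -
    let ?r = "dist x y / l"
    have "\<bar>x $ j - y $ j\<bar> \<le> ?r * v $ j" for j
    proof -
      have "\<bar>x $ j - y $ j\<bar> \<le> dist x y"
        using component_le_norm_cart[of "x - y" j] by (simp add: dist_norm)
      also have "\<dots> \<le> ?r * v $ j" using l by (simp add: field_simps mult_right_mono)
      finally show ?thesis .
    qed
    then have it: "\<bar>((F ^^ n) x - (F ^^ n) y) $ i\<bar> \<le> c ^ n * ?r * v $ i" for i
      using iterate[of ?r x y n i] l(1) by simp
    have "dist ((F ^^ n) x) ((F ^^ n) y) \<le> (\<Sum>i\<in>UNIV. \<bar>((F ^^ n) x - (F ^^ n) y) $ i\<bar>)"
      unfolding dist_norm by (rule norm_le_l1_cart)
    also have "\<dots> \<le> (\<Sum>i\<in>UNIV. c ^ n * ?r * v $ i)" by (rule sum_mono) (rule it)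
    also have "\<dots> = (c ^ n * K) * dist x y"
      by (simp add: K_def sum_distrib_left sum_distrib_right sum_divide_distrib ac_simps)
    finally show ?thesis .
  qed
  then have ex1: "\<exists>!x. (F ^^ n) x = x"
    using banach_fix_type[of "c ^ n * K" "F ^^ n"] n c0 K by simp
  then obtain z where z: "(F ^^ n) z = z" by blast
  \<comment> \<open>\<open>F\<close> commutes with its iterate, so it maps the unique fixed point of
    the iterate to itself.\<close>
  have "(F ^^ n) (F z) = F z" by (simp add: funpow_swap1[symmetric] z)
  then have "F z = z" using ex1 z by blast
  moreover have "(F ^^ n) x = x" if "F x = x" for x using that by (induction n) auto
  ultimately show ?thesis using ex1 by metis
qed

section \<open>Positive definite matrices\<close>

text \<open>The form attains a positive minimum on the unit sphere; homogeneity of degree two does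
  the rest.\<close>

lemma positive_definite_coercive:
  fixes B :: "real ^ 'n ^ 'n"
  assumes "\<And>z. z \<noteq> 0 \<Longrightarrow> z \<bullet> (B *v z) > 0"
  obtains c where "c > 0" "\<And>z. z \<bullet> (B *v z) \<ge> c * (norm z)\<^sup>2"
proof -
  have "continuous_on (sphere 0 1) (\<lambda>z. z \<bullet> (B *v z))"
    by (intro continuous_intros linear_continuous_on matrix_vector_mul_bounded_linear)
  moreover have "axis undefined 1 \<in> sphere (0 :: real ^ 'n) 1" by simp
  ultimately obtain u where u: "u \<in> sphere 0 1" "\<And>z. z \<in> sphere 0 1 \<Longrightarrow> u \<bullet> (B *v u) \<le> z \<bullet> (B *v z)"
    using continuous_attains_inf[of "sphere (0 :: real ^ 'n) 1" "\<lambda>z. z \<bullet> (B *v z)"] by auto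
  have "u \<noteq> 0" using u(1) by auto
  moreover have "u \<bullet> (B *v u) * (norm z)\<^sup>2 \<le> z \<bullet> (B *v z)" for z
  proof (cases "z = 0")
    case False
    let ?e = "(1 / norm z) *\<^sub>R z"
    have "u \<bullet> (B *v u) \<le> ?e \<bullet> (B *v ?e)" using False by (intro u(2)) simp
    also have "\<dots> = z \<bullet> (B *v z) / (norm z)\<^sup>2"
      by (simp add: matrix_vector_mult_scaleR power2_eq_square)
    finally show ?thesis using False by (simp add: field_simps)
  qed simp
  ultimately show thesis using that assms by blast
qed

text \<open>Expanding the square leaves the factor
  \<open>\<kappa>\<^sup>2 - 2 * \<kappa> * c + L\<^sup>2\<close>; its ratio to
  \<open>\<kappa>\<^sup>2\<close> is smallest at \<open>\<kappa> = L\<^sup>2 / c\<close>, where it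
  equals \<open>1 - c\<^sup>2 / L\<^sup>2\<close>.\<close>

lemma forward_step_contraction:
  fixes B :: "real ^ 'n ^ 'n"
  assumes "\<And>z. z \<noteq> 0 \<Longrightarrow> z \<bullet> (B *v z) > 0"
  obtains \<kappa> q where "\<kappa> > 0" "0 \<le> q" "q < 1" "\<And>z. norm (\<kappa> *\<^sub>R z - B *v z) \<le> q * (\<kappa> * norm z)"
proof -
  obtain c where c: "c > 0" "\<And>z. z \<bullet> (B *v z) \<ge> c * (norm z)\<^sup>2"
    using positive_definite_coercive[OF assms] by blast
  obtain L0 where L0: "\<And>z. norm (B *v z) \<le> norm z * L0"
    using bounded_linear.bounded[OF matrix_vector_mul_bounded_linear[of B]] by blast
  \<comment> \<open>The maximum with \<open>c\<close> guarantees \<open>0 < c \<le> L\<close>, so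
    the square root defining \<open>q\<close> has a nonnegative argument.\<close>
  define L where "L = max L0 c"
  have L: "L > 0" "L \<ge> c" using c by (auto simp: L_def)
  have BL: "norm (B *v z) \<le> L * norm z" for z
    using L0[of z] by (rule order_trans) (simp add: L_def mult.commute[of _ "norm z"] mult_left_mono)
  define \<kappa> where "\<kappa> = L\<^sup>2 / c"
  define q where "q = sqrt (1 - c\<^sup>2 / L\<^sup>2)"
  have \<kappa>: "\<kappa> > 0" using c L by (simp add: \<kappa>_def)
  have "c\<^sup>2 / L\<^sup>2 \<le> 1" "c\<^sup>2 / L\<^sup>2 > 0" using c L by (simp_all add: power_mono)
  then have q: "0 \<le> q" "q < 1" "q\<^sup>2 = 1 - c\<^sup>2 / L\<^sup>2" by (simp_all add: q_def)
  have "norm (\<kappa> *\<^sub>R z - B *v z) \<le> q * (\<kappa> * norm z)" for z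
  proof (rule power2_le_imp_le)
    have "(norm (\<kappa> *\<^sub>R z - B *v z))\<^sup>2 = \<kappa>\<^sup>2 * (norm z)\<^sup>2 - 2 * \<kappa> * (z \<bullet> (B *v z)) + (norm (B *v z))\<^sup>2"
      unfolding power2_norm_eq_inner by (simp add: inner_diff inner_commute power2_eq_square algebra_simps)
    also have "\<dots> \<le> \<kappa>\<^sup>2 * (norm z)\<^sup>2 - 2 * \<kappa> * (c * (norm z)\<^sup>2) + (L * norm z)\<^sup>2"
      using c(2)[of z] \<kappa> BL[of z] by (intro add_mono diff_mono mult_left_mono power_mono) auto
    also have "\<dots> = (\<kappa>\<^sup>2 - 2 * \<kappa> * c + L\<^sup>2) * (norm z)\<^sup>2"
      by (simp add: algebra_simps power_mult_distrib)
    also have "\<kappa>\<^sup>2 - 2 * \<kappa> * c + L\<^sup>2 = q\<^sup>2 * \<kappa>\<^sup>2"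
      unfolding q(3) using c(1) L(1) by (simp add: \<kappa>_def field_simps power2_eq_square)
    finally show "(norm (\<kappa> *\<^sub>R z - B *v z))\<^sup>2 \<le> (q * (\<kappa> * norm z))\<^sup>2"
      by (simp add: power_mult_distrib mult.assoc)
    show "0 \<le> q * (\<kappa> * norm z)" using q \<kappa> by simp
  qed
  then show thesis using that \<kappa> q by blast
qed

section \<open>The consumer game\<close>

lemma diag_matrix_vector_mult: "(diag_matrix d *v x) $ i = d $ i * x $ i"
  by (simp add: matrix_vector_mult_def diag_matrix_def mult_delta_left)

lemma diag_matrix_matrix_mult: "(diag_matrix d ** M) $ i $ j = d $ i * M $ i $ j"
  by (simp add: matrix_matrix_mult_def diag_matrix_def mult_delta_left)

lemma matrix_inv_diag_matrix:
  fixes d :: "real ^ 'n"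
  assumes "\<And>i. d $ i \<noteq> 0"
  shows "matrix_inv (diag_matrix d) = diag_matrix (\<chi> i. 1 / d $ i)"
proof -
  let ?E = "diag_matrix (\<chi> i. 1 / d $ i)"
  have *: "diag_matrix d ** ?E = mat 1" "?E ** diag_matrix d = mat 1"
    using assms by (simp_all add: vec_eq_iff diag_matrix_matrix_mult)
      (simp_all add: diag_matrix_def mat_def)
  then have "diag_matrix d ** matrix_inv (diag_matrix d) = mat 1
      \<and> matrix_inv (diag_matrix d) ** diag_matrix d = mat 1"
    unfolding matrix_inv_def by (intro someI) blast
  then show ?thesis using * by (metis matrix_mul_assoc matrix_mul_lid matrix_mul_rid)
qed

text \<open>The profile \<open>x\<close> inside the marginal value stays fixed while the own action
  varies, so a best response minimizes \<open>h i\<close> tilted by a constant slope.\<close>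

lemma nash_equilibrium_iff_vi:
  assumes scp: "\<And>i. strongly_convex_potential (X i) (h i) (h' i) (m i)"
  shows "nash_equilibrium a b \<delta> G h X p x \<longleftrightarrow>
    (\<forall>i. x $ i \<in> X i \<and>
      (\<forall>z\<in>X i. 0 \<le> (h' i (x $ i) - marginal_value a b \<delta> G i x (p $ i)) * (z - x $ i)))"
proof -
  have "x $ i \<in> best_response a b \<delta> G h X i x (p $ i) \<longleftrightarrow>
      strongly_convex_potential.solves_vi (X i) (h' i) (marginal_value a b \<delta> G i x (p $ i)) (x $ i)" for i
    unfolding strongly_convex_potential.solves_vi_iff_minimizer[OF scp]
      best_response_def is_arg_max_def utility_def by (auto simp: not_less algebra_simps)
  then show ?thesis
    unfolding nash_equilibrium_def strongly_convex_potential.solves_vi_def[OF scp] by blast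
qed

theorem theorem2:
  fixes G :: "real ^ 'n ^ 'n" and \<delta> :: real and a b \<mu> :: "real ^ 'n"
    and P :: "(real ^ 'n) set"
    and X :: "'n \<Rightarrow> real set"
    and h h' :: "'n \<Rightarrow> real \<Rightarrow> real"
  assumes "\<delta> \<ge> 0"
    and "\<And>i. G $ i $ i = 0"
    and "closed P" and "convex P"
    and "\<And>i. X i \<subseteq> {0..}"
    and "\<And>i. convex_on (X i) (h i)"
    and "\<And>i x. x \<in> X i \<Longrightarrow> (h i has_real_derivative h' i x) (at x within X i)"
    and "\<And>i. continuous_on (X i) (h' i)"
    and "(\<forall>i. X i \<noteq> {} \<and> convex (X i) \<and> compact (X i)) \<or>
         (\<forall>i. X i \<noteq> {} \<and> convex (X i) \<and> closed (X i) \<and>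
              filterlim (\<lambda>x. h i x / \<bar>x\<bar>) at_top (inf at_infinity (principal (X i))))"
    and "\<And>i. \<mu> $ i > 0"
    and "\<And>i x y. x \<in> X i \<Longrightarrow> y \<in> X i \<Longrightarrow>
           h i y \<ge> h i x + h' i x * (y - x) + \<mu> $ i / 2 * \<bar>y - x\<bar>\<^sup>2"
    and "matrix_spectral_radius (\<delta> *\<^sub>R (matrix_inv (diag_matrix \<mu>) ** abs_matrix G)) < 1 \<or>
         diag_matrix \<mu> - \<delta> *\<^sub>R ((1 / 2) *\<^sub>R (G + transpose G)) \<succ>\<^sub>M 0"
  shows "\<forall>p\<in>P. \<exists>!x. nash_equilibrium a b \<delta> G h X p x"
proof
  fix p
  have X: "X i \<noteq> {}" "closed (X i)" "convex (X i)" for i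
    using assms(9) by (auto simp: compact_imp_closed)
  have scp: "strongly_convex_potential (X i) (h i) (h' i) (\<mu> $ i)" for i
    using X assms(7,10) assms(11)[of _ i] by unfold_locales auto
  let ?s = "\<lambda>x i. marginal_value a b \<delta> G i x (p $ i)"
  let ?vi = "\<lambda>x. \<forall>i. x $ i \<in> X i \<and> (\<forall>z\<in>X i. 0 \<le> (h' i (x $ i) - ?s x i) * (z - x $ i))"
  have s_diff: "?s x i - ?s y i = \<delta> * (\<Sum>j\<in>UNIV. G $ i $ j * (x $ j - y $ j))" for x y i
    by (simp add: marginal_value_def algebra_simps sum_subtractf)
  have "\<exists>!x. ?vi x"
    using assms(12)
  proof
    let ?A = "\<delta> *\<^sub>R (matrix_inv (diag_matrix \<mu>) ** abs_matrix G)"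
    assume radius: "matrix_spectral_radius ?A < 1"
    have A: "?A $ i $ j = \<delta> * \<bar>G $ i $ j\<bar> / \<mu> $ i" for i j
    proof -
      have "matrix_inv (diag_matrix \<mu>) = diag_matrix (\<chi> i. 1 / \<mu> $ i)"
        by (rule matrix_inv_diag_matrix) (metis assms(10) less_irrefl)
      then show ?thesis
        by (simp add: diag_matrix_matrix_mult abs_matrix_def)
    qed
    obtain F where F: "\<And>x. F x = x \<longleftrightarrow> ?vi x"
      and lip: "\<And>x y i. \<bar>F x $ i - F y $ i\<bar> \<le> \<bar>?s x i - ?s y i\<bar> / \<mu> $ i"
      by (rule vi_fixed_point_map[where s = ?s and X = X, OF scp]) (rule that)
    have "\<exists>!x. F x = x"
    proof (rule matrix_contraction_fixed_point[OF _ radius])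
      show "?A $ i $ j \<ge> 0" for i j
        unfolding A using assms(1) assms(10)[of i] by simp
      show "\<bar>F x $ i - F y $ i\<bar> \<le> (\<Sum>j\<in>UNIV. ?A $ i $ j * \<bar>x $ j - y $ j\<bar>)" for x y i
      proof -
        have "\<bar>?s x i - ?s y i\<bar> \<le> \<delta> * (\<Sum>j\<in>UNIV. \<bar>G $ i $ j\<bar> * \<bar>x $ j - y $ j\<bar>)"
          unfolding s_diff abs_mult abs_of_nonneg[OF assms(1)]
          by (intro mult_left_mono assms(1) order_trans[OF sum_abs]) (simp add: abs_mult)
        then have "\<bar>?s x i - ?s y i\<bar> / \<mu> $ i \<le> (\<Sum>j\<in>UNIV. ?A $ i $ j * \<bar>x $ j - y $ j\<bar>)"
          unfolding A using assms(10)[of i]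
          by (simp add: divide_right_mono sum_distrib_left sum_divide_distrib[symmetric] mult.assoc)
        then show ?thesis using lip[where x = x and y = y and i = i] by linarith
      qed
    qed
    then show ?thesis unfolding F .
  next
    assume succ: "diag_matrix \<mu> - \<delta> *\<^sub>R ((1 / 2) *\<^sub>R (G + transpose G)) \<succ>\<^sub>M 0"
    \<comment> \<open>\<open>B\<close> keeps \<open>G\<close> unsymmetrized, as the equilibrium
      inequality does; its quadratic form agrees with that of the symmetrized matrix.\<close>
    define B where "B = diag_matrix \<mu> - \<delta> *\<^sub>R G"
    have Bz: "(B *v z) $ i = \<mu> $ i * z $ i - \<delta> * (\<Sum>j\<in>UNIV. G $ i $ j * z $ j)" for z i
      by (simp add: B_def matrix_vector_mult_diff_rdistrib diag_matrix_vector_mult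
          scaleR_matrix_vector_assoc[symmetric]) (simp add: matrix_vector_mult_def)
    have "z \<bullet> (B *v z) > 0" if "z \<noteq> 0" for z
    proof -
      have "z \<bullet> (transpose G *v z) = z \<bullet> (G *v z)"
        by (metis dot_lmul_matrix inner_commute transpose_matrix_vector)
      then have "z \<bullet> ((diag_matrix \<mu> - \<delta> *\<^sub>R ((1 / 2) *\<^sub>R (G + transpose G))) *v z) = z \<bullet> (B *v z)"
        by (simp add: B_def matrix_vector_mult_diff_rdistrib matrix_vector_mult_add_rdistrib
            scaleR_matrix_vector_assoc[symmetric] inner_diff inner_add)
      then show ?thesis using succ that by (metis inner_zero_right matrix_succ_def matrix_vector_mult_0)
    qed
    then obtain \<kappa> q where \<kappa>: "\<kappa> > 0" and q: "0 \<le> q" "q < 1"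
      and step: "\<And>z. norm (\<kappa> *\<^sub>R z - B *v z) \<le> q * (\<kappa> * norm z)"
      using forward_step_contraction by blast
    \<comment> \<open>The term with \<open>\<mu> $ i\<close> hands the strong convexity over to
      \<open>B\<close>, and the one with \<open>\<kappa>\<close> is proximal. Both recur in
      \<open>?t\<close>, so they cancel at a fixed point.\<close>
    let ?\<phi> = "\<lambda>i y. h i y - \<mu> $ i * y\<^sup>2 / 2 + \<kappa> * y\<^sup>2 / 2"
    let ?\<phi>' = "\<lambda>i y. h' i y - \<mu> $ i * y + \<kappa> * y"
    let ?t = "\<lambda>x i. ?s x i - \<mu> $ i * x $ i + \<kappa> * x $ i"
    have scp': "strongly_convex_potential (X i) (?\<phi> i) (?\<phi>' i) \<kappa>" for i
    proof
      fix x y assume xy: "x \<in> X i" "y \<in> X i"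
      show "(?\<phi> i has_real_derivative ?\<phi>' i x) (at x within X i)"
        by (auto intro!: derivative_eq_intros assms(7)[OF xy(1)])
      show "?\<phi> i x + ?\<phi>' i x * (y - x) + \<kappa> / 2 * (y - x)\<^sup>2 \<le> ?\<phi> i y"
        using assms(11)[OF xy] by (simp add: field_simps power2_eq_square)
    qed (use X \<kappa> in auto)
    obtain F where F: "\<And>x. F x = x \<longleftrightarrow>
        (\<forall>i. x $ i \<in> X i \<and> (\<forall>z\<in>X i. 0 \<le> (?\<phi>' i (x $ i) - ?t x i) * (z - x $ i)))"
      and lip: "\<And>x y i. \<bar>F x $ i - F y $ i\<bar> \<le> \<bar>?t x i - ?t y i\<bar> / \<kappa>"
      by (rule vi_fixed_point_map[where s = ?t and X = X, OF scp']) (rule that)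
    have "dist (F x) (F y) \<le> q * dist x y" for x y
    proof -
      \<comment> \<open>Up to a constant, \<open>?t x\<close> is
        \<open>\<kappa> *\<^sub>R x - B *v x\<close>, the explicit step scaled by
        \<open>\<kappa>\<close>.\<close>
      have t_diff: "?t x i - ?t y i = (\<kappa> *\<^sub>R (x - y) - B *v (x - y)) $ i" for i
        using s_diff[where x = x and y = y and i = i]
        by (simp add: Bz algebra_simps sum_subtractf)
      have "norm (\<kappa> *\<^sub>R (F x - F y)) \<le> norm (\<kappa> *\<^sub>R (x - y) - B *v (x - y))"
        using lip[where x = x and y = y] \<kappa> unfolding t_diff
        by (intro norm_le_componentwise_cart) (simp add: abs_mult pos_le_divide_eq mult.commute[of _ \<kappa>])
      also have "\<dots> \<le> q * (\<kappa> * norm (x - y))" by (rule step)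
      finally show ?thesis using \<kappa> by (simp add: dist_norm)
    qed
    then have "\<exists>!x. F x = x" using q by (intro banach_fix_type) auto
    moreover have "?\<phi>' i (x $ i) - ?t x i = h' i (x $ i) - ?s x i" for x i by simp
    ultimately show ?thesis unfolding F by simp
  qed
  then show "\<exists>!x. nash_equilibrium a b \<delta> G h X p x"
    unfolding nash_equilibrium_iff_vi[OF scp] .
qed

end
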